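(* Under the exponential model $\widehat S_{ij}(\tau_p)=e^{-h_{ij}\tau_p}$, the acquisition index $$I_{ij}=\widehat S_{ij}(\tau_p)\,\bigl(\overline V_{ij,n}-\underline V_{ij,n}\bigr)-c_p-\Omega_j,\qquad \Omega_j=\bigl(1-\widehat S_{ij}(\tau_p)\bigr)\bigl[\underline V_{ij,n}-v_0\bigr]_+,$$ is non-increasing in the hazard $h_{ij}$, holding the value bounds $\underline V_{ij,n},\overline V_{ij,n}$ and $v_0$ fixed. Hence higher hazard weakly shrinks the probe-eligible set $\{j:I_{ij}>0\}$.
   Context: Receiver $i$ has a finite set of current peers $j$. $\underline V_{ij,n}\le\overline V_{ij,n}$ are lower and upper confidence bounds on the realisable value of exchanging with $j$; $v_0$ is a deterministic fallback value; $c_p$ is the probe cost; $\tau_p>0$ the probe duration; $h_{ij}\ge0$ the link hazard rate; $[x]_+=\max\{x,0\}$. *)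

theory Defs
  imports Complex_Main
begin

definition exp_survival :: "real \<Rightarrow> real \<Rightarrow> real" where
  "exp_survival h t = exp (- h * t)"

(* The penalty Omega_j: s is the survival probability over the probe duration, and
   max (lo - v0) 0 is the positive part [lo - v0]_+. *)
definition deferral_penalty :: "real \<Rightarrow> real \<Rightarrow> real \<Rightarrow> real" where
  "deferral_penalty s lo v0 = (1 - s) * max (lo - v0) 0"

definition acquisition_index :: "real \<Rightarrow> real \<Rightarrow> real \<Rightarrow> real \<Rightarrow> real \<Rightarrow> real" where
  "acquisition_index s lo hi v0 cp = s * (hi - lo) - cp - deferral_penalty s lo v0"

definition probe_eligible :: "'a set \<Rightarrow> ('a \<Rightarrow> real) \<Rightarrow> 'a set" where
  "probe_eligible N I = {j \<in> N. I j > 0}"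

end

theory Submission
  imports Defs
begin

text \<open>Hazard enters the index only through the survival probability \<open>s\<close>.
  Expanding the penalty makes the index affine in \<open>s\<close>, with slope
  \<open>hi - lo + max (lo - v0) 0\<close>: survival both scales the value gap and reduces the
  penalty. This slope is nonnegative, and \<open>s = exp (- h * t)\<close> falls as \<open>h\<close>
  grows, so the index falls too. Eligibility is a strict superlevel set, hence shrinks with the
  index.\<close>

lemma acquisition_index_affine_in_survival:
  "acquisition_index s lo hi v0 cp = s * (hi - lo + max (lo - v0) 0) - (cp + max (lo - v0) 0)"
  by (simp add: acquisition_index_def deferral_penalty_def algebra_simps)

text \<open>The ordering \<open>lo \<le> hi\<close> of the bounds makes the slope a sum of two
  nonnegative terms.\<close>

lemma acquisition_index_mono_survival:
  assumes "s \<le> s'" and "lo \<le> hi"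
  shows "acquisition_index s lo hi v0 cp \<le> acquisition_index s' lo hi v0 cp"
  unfolding acquisition_index_affine_in_survival
  using assms by (intro diff_right_mono mult_right_mono) auto

lemma exp_survival_antimono_hazard:
  assumes "h \<le> h'" and "0 \<le> t"
  shows "exp_survival h' t \<le> exp_survival h t"
  using mult_right_mono[OF assms] by (simp add: exp_survival_def)

lemma probe_eligible_mono:
  assumes "\<And>j. j \<in> N \<Longrightarrow> I j \<le> I' j"
  shows "probe_eligible N I \<subseteq> probe_eligible N I'"
  using assms by (force simp: probe_eligible_def)

theorem proposition6:
  fixes peers :: "'a \<Rightarrow> 'a set"
    and lo hi :: "'a \<Rightarrow> 'a \<Rightarrow> nat \<Rightarrow> real"
    and v0 cp \<tau> :: real
    and i :: 'a and n :: nat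
  assumes "finite (peers i)"
    and "\<And>j. j \<in> peers i \<Longrightarrow> lo i j n \<le> hi i j n"
    and "\<tau> > 0"
  shows "(\<forall>j\<in>peers i. antimono_on {0..}
            (\<lambda>h. acquisition_index (exp_survival h \<tau>) (lo i j n) (hi i j n) v0 cp)) \<and>
         (\<forall>h h' :: 'a \<Rightarrow> 'a \<Rightarrow> real.
            (\<forall>j\<in>peers i. 0 \<le> h i j \<and> h i j \<le> h' i j) \<longrightarrow>
            probe_eligible (peers i)
              (\<lambda>j. acquisition_index (exp_survival (h' i j) \<tau>) (lo i j n) (hi i j n) v0 cp)
            \<subseteq> probe_eligible (peers i)
              (\<lambda>j. acquisition_index (exp_survival (h i j) \<tau>) (lo i j n) (hi i j n) v0 cp))"
proof -
  \<comment> \<open>Comparing two hazard values at one peer serves both conjuncts: antitonicity at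
    that peer, and the comparison of indices peer by peer when hazards vary with
    \<open>j\<close>.\<close>
  have index_antimono:
    "acquisition_index (exp_survival b \<tau>) (lo i j n) (hi i j n) v0 cp
       \<le> acquisition_index (exp_survival a \<tau>) (lo i j n) (hi i j n) v0 cp"
    if "j \<in> peers i" "a \<le> b" for j a b
    using that assms by (intro acquisition_index_mono_survival exp_survival_antimono_hazard) auto
  show ?thesis
    using index_antimono by (intro conjI ballI allI impI monotone_onI probe_eligible_mono) auto
qed

end
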